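(* Let $f$ be a Möbius transformation with $f(\mathbb{H}^n)=\mathbb{H}^n$. Then for all $x,y\in\mathbb{H}^n$, we have $$u_{\mathbb{H}^n}(x,y)-2\log 2\le u_{\mathbb{H}^n}(f(x),f(y))\le u_{\mathbb{H}^n}(x,y)+2\log 2,$$ and both inequalities are sharp.
   Context: $\overline{\mathbb{R}}^n=\mathbb{R}^n\cup\{\infty\}$; a Möbius transformation of $\overline{\mathbb{R}}^n$ is a finite composition of reflections (inversions) in spheres and hyperplanes. $\mathbb{H}^n=\{x=(x_1,\dots,x_n)\in\mathbb{R}^n:x_n>0\}$, and $|\cdot|$ is the Euclidean norm. For a domain $D\subsetneq\mathbb{R}^n$ and $x\in D$, $d(x)$ denotes the Euclidean distance from $x$ to the boundary of $D$, and the Gromov hyperbolic metric $u_D$ is $$u_D(x,y)=2\log\frac{|x-y|+\max\{d(x),d(y)\}}{\sqrt{d(x)\,d(y)}},\qquad x,y\in D.$$ For $D=\mathbb{H}^n$ one has $d(x)=x_n$. "Sharp" means that in neither inequality can the constant $2\log 2$ be replaced by a smaller constant so that the inequality holds for all such $f$ and all $x,y\in\mathbb{H}^n$.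
   Formalization: Sharpness of the two inequalities is claimed only for n ≥ 2; for n = 1 every such f is x ↦ ax or x ↦ a/x and preserves u exactly, so sharpness fails there. The inequalities themselves are stated for all n ≥ 1. *)

theory Defs
  imports "HOL-Analysis.Analysis"
begin

text \<open>
  The one-point compactification of a Euclidean space is represented by \<open>option\<close>, as in
  \<^const>\<open>Alexandroff_compactification\<close>: \<open>Some x\<close> is the finite point \<open>x\<close>, and \<open>None\<close> is \<open>\<infinity>\<close>.
\<close>

text \<open>Reflection in the hyperplane \<open>{x. a \<bullet> x = b}\<close>, where \<open>a \<noteq> 0\<close>.\<close>

definition hyperplane_reflection ::
    "'a::euclidean_space \<Rightarrow> real \<Rightarrow> 'a option \<Rightarrow> 'a option" where
  "hyperplane_reflection a b p =
     (case p of
        None \<Rightarrow> None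
      | Some x \<Rightarrow> Some (x - (2 * (a \<bullet> x - b) / (norm a)\<^sup>2) *\<^sub>R a))"

text \<open>Reflection (inversion) in the sphere with centre \<open>a\<close> and radius \<open>r > 0\<close>.\<close>

definition sphere_inversion ::
    "'a::euclidean_space \<Rightarrow> real \<Rightarrow> 'a option \<Rightarrow> 'a option" where
  "sphere_inversion a r p =
     (case p of
        None \<Rightarrow> Some a
      | Some x \<Rightarrow> if x = a then None else Some (a + (r / norm (x - a))\<^sup>2 *\<^sub>R (x - a)))"

inductive moebius :: "('a::euclidean_space option \<Rightarrow> 'a option) \<Rightarrow> bool" where
  hyperplane: "a \<noteq> 0 \<Longrightarrow> moebius (hyperplane_reflection a b)"
| sphere: "r > 0 \<Longrightarrow> moebius (sphere_inversion a r)"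
| compose: "moebius f \<Longrightarrow> moebius g \<Longrightarrow> moebius (f \<circ> g)"

text \<open>
  The index \<open>k\<close> selects the distinguished coordinate (the last one in the usual
  numbering), since a finite index type carries no preferred order.
\<close>

definition half_space :: "'n::finite \<Rightarrow> (real ^ 'n) set" where
  "half_space k = {x. x $ k > 0}"

definition moebius_preserving ::
    "'a::euclidean_space set \<Rightarrow> ('a option \<Rightarrow> 'a option) \<Rightarrow> bool" where
  "moebius_preserving D f \<longleftrightarrow> moebius f \<and> f ` (Some ` D) = Some ` D"

definition gromov_hyp_metric :: "'a::euclidean_space set \<Rightarrow> 'a \<Rightarrow> 'a \<Rightarrow> real" where
  "gromov_hyp_metric D x y =
     (let d = (\<lambda>z. infdist z (frontier D))
      in 2 * ln ((norm (x - y) + max (d x) (d y)) / sqrt (d x * d y)))"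

text \<open>
  The metric between the images of two finite points. The use of \<^const>\<open>the\<close> is
  harmless when \<open>f\<close> maps \<open>D\<close> onto itself and \<open>x, y \<in> D\<close>.
\<close>

definition gromov_hyp_image ::
    "'a::euclidean_space set \<Rightarrow> ('a option \<Rightarrow> 'a option) \<Rightarrow> 'a \<Rightarrow> 'a \<Rightarrow> real" where
  "gromov_hyp_image D f x y = gromov_hyp_metric D (the (f (Some x))) (the (f (Some y)))"

end

theory Submission
  imports Defs "HOL-Real_Asymp.Real_Asymp"
begin

text \<open>
  On \<open>H = {x. x $ k > 0}\<close> the distance to the boundary is the height \<open>x $ k\<close>, so
  \<open>u(x, y) = 2 ln (s + q)\<close> with \<open>s = |x - y| / sqrt (x $ k * y $ k)\<close> and
  \<open>q = max (x $ k) (y $ k) / sqrt (x $ k * y $ k)\<close>. The number \<open>s\<close> is a function of the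
  hyperbolic distance (it is \<open>2 sinh (\<rho> / 2)\<close>), hence a Moebius invariant, while \<open>q\<close> is the square
  root of the ratio of the heights and may change. As heights differ by at most \<open>|x - y|\<close>, one has
  \<open>1 \<le> q \<le> s + 1\<close>; therefore passing to \<open>q'\<close> multiplies \<open>s + q\<close> by at most
  \<open>(2 s + 1) / (s + 1) < 2\<close>, which gives both inequalities.

  The invariance of \<open>s\<close> (\<open>moebius_half_space_invariant\<close>) is obtained without a classification of
  Moebius maps. Every composition \<open>f\<close> of reflections has a positive weight \<open>w\<close> with
  \<open>w x * w y * |f x - f y|\<^sup>2 = |x - y|\<^sup>2\<close>, and for every function
  \<open>Q x = \<alpha> |x|\<^sup>2 + \<beta> \<bullet> x + \<gamma>\<close>, whose zeros form a sphere or a hyperplane when its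
  discriminant \<open>|\<beta>|\<^sup>2 - 4 \<alpha> \<gamma>\<close> is positive, the function \<open>w x * Q (f x)\<close> has the same shape
  and the same discriminant. Applied to the height \<open>Q x = x $ k\<close>, of discriminant \<open>1\<close>, this yields a function of discriminant \<open>1\<close> that is
  positive exactly on \<open>H\<close>, because \<open>f\<close> is injective and maps \<open>H\<close> onto \<open>H\<close>; the only such function
  is the height again (\<open>sphere_form_pos_on_half_space\<close>). So \<open>w x * f(x) $ k = x $ k\<close>, and the
  weights cancel in \<open>s\<close>.

  For sharpness, inversion in the unit sphere can move two points on one vertical line, off its
  centre, to two points of equal height. There \<open>q\<close> is as large as \<open>s\<close> permits,
  up to a bounded error, and becomes \<open>1\<close>; as \<open>s \<rightarrow> \<infinity>\<close> the factor tends to \<open>2\<close>. The inversion is an involution, so the same points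
  serve for both inequalities.
\<close>

section \<open>Conformal weights of Moebius transformations\<close>

text \<open>
  The squared distance in the light-cone model, where \<open>x\<close> is lifted to \<open>(1, x, |x|\<^sup>2)\<close> and
  \<open>\<infinity>\<close> to \<open>(0, 0, 1)\<close>: it is the Lorentzian pairing of the lifts. These values at \<open>\<infinity>\<close> let the
  identities below hold at every point, poles included, so that they survive composition.
\<close>

definition ext_dist_sq :: "'a::euclidean_space option \<Rightarrow> 'a option \<Rightarrow> real" where
  "ext_dist_sq p q =
     (case p of
        None \<Rightarrow> (case q of None \<Rightarrow> 0 | Some y \<Rightarrow> 1)
      | Some x \<Rightarrow> (case q of None \<Rightarrow> 1 | Some y \<Rightarrow> (norm (x - y))\<^sup>2))"

text \<open>
  A linear functional on the light-cone model. If its discriminant is positive, its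
  restriction to finite points vanishes on a sphere or hyperplane. Its value at
  \<open>\<infinity>\<close> is the leading coefficient.
\<close>

definition sphere_form :: "real \<Rightarrow> 'a::euclidean_space \<Rightarrow> real \<Rightarrow> 'a option \<Rightarrow> real" where
  "sphere_form \<alpha> \<beta> \<gamma> p =
     (case p of None \<Rightarrow> \<alpha> | Some x \<Rightarrow> \<alpha> * (x \<bullet> x) + \<beta> \<bullet> x + \<gamma>)"

text \<open>
  In the light-cone model, this says that \<open>f\<close> is induced by a Lorentz transformation: \<open>w\<close> is the
  factor by which the lift of a point has to be rescaled, and the last clause is invariance of the
  dual quadratic form \<open>\<beta> \<bullet> \<beta> - 4 * \<alpha> * \<gamma>\<close>.
\<close>

definition conformal_weight ::
    "('a::euclidean_space option \<Rightarrow> real) \<Rightarrow> ('a option \<Rightarrow> 'a option) \<Rightarrow> bool" where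
  "conformal_weight w f \<longleftrightarrow>
     (\<forall>p. w p > 0) \<and>
     (\<forall>p q. w p * w q * ext_dist_sq (f p) (f q) = ext_dist_sq p q) \<and>
     (\<forall>\<alpha> \<beta> \<gamma>. \<exists>\<alpha>' \<beta>' \<gamma>'. \<beta>' \<bullet> \<beta>' - 4 * \<alpha>' * \<gamma>' = \<beta> \<bullet> \<beta> - 4 * \<alpha> * \<gamma> \<and>
        (\<forall>p. w p * sphere_form \<alpha> \<beta> \<gamma> (f p) = sphere_form \<alpha>' \<beta>' \<gamma>' p))"

lemma ext_dist_sq_eq_0_iff [simp]: "ext_dist_sq p q = 0 \<longleftrightarrow> p = q"
  by (auto simp: ext_dist_sq_def split: option.splits)

lemma conformal_weight_inj:
  assumes "conformal_weight w f"
  shows "inj f"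
proof (rule injI)
  fix p q assume "f p = f q"
  moreover have "ext_dist_sq p q = w p * w q * ext_dist_sq (f p) (f q)"
    using assms by (simp only: conformal_weight_def)
  ultimately have "ext_dist_sq p q = 0" by simp
  then show "p = q" by simp
qed

lemma conformal_weight_compose:
  assumes f: "conformal_weight w f" and g: "conformal_weight v g"
  shows "conformal_weight (\<lambda>p. v p * w (g p)) (f \<circ> g)"
  unfolding conformal_weight_def
proof (intro conjI allI)
  fix p show "v p * w (g p) > 0"
    using f g by (simp add: conformal_weight_def)
next
  fix p q
  have "v p * w (g p) * (v q * w (g q)) * ext_dist_sq ((f \<circ> g) p) ((f \<circ> g) q)
      = v p * v q * (w (g p) * w (g q) * ext_dist_sq (f (g p)) (f (g q)))"
    by (simp add: mult_ac)
  also have "\<dots> = ext_dist_sq p q"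
    using f g by (simp add: conformal_weight_def)
  finally show "v p * w (g p) * (v q * w (g q)) * ext_dist_sq ((f \<circ> g) p) ((f \<circ> g) q)
      = ext_dist_sq p q" .
next
  fix \<alpha> \<beta> \<gamma>
  obtain \<alpha>1 \<beta>1 \<gamma>1 where 1: "\<beta>1 \<bullet> \<beta>1 - 4 * \<alpha>1 * \<gamma>1 = \<beta> \<bullet> \<beta> - 4 * \<alpha> * \<gamma>"
    "\<And>p. w p * sphere_form \<alpha> \<beta> \<gamma> (f p) = sphere_form \<alpha>1 \<beta>1 \<gamma>1 p"
    using f unfolding conformal_weight_def by metis
  obtain \<alpha>2 \<beta>2 \<gamma>2 where 2: "\<beta>2 \<bullet> \<beta>2 - 4 * \<alpha>2 * \<gamma>2 = \<beta>1 \<bullet> \<beta>1 - 4 * \<alpha>1 * \<gamma>1"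
    "\<And>p. v p * sphere_form \<alpha>1 \<beta>1 \<gamma>1 (g p) = sphere_form \<alpha>2 \<beta>2 \<gamma>2 p"
    using g unfolding conformal_weight_def by metis
  have "v p * w (g p) * sphere_form \<alpha> \<beta> \<gamma> ((f \<circ> g) p) = sphere_form \<alpha>2 \<beta>2 \<gamma>2 p" for p
    using 1(2)[of "g p"] 2(2)[of p] by (simp add: mult.assoc)
  with 1(1) 2(1) show "\<exists>\<alpha>' \<beta>' \<gamma>'. \<beta>' \<bullet> \<beta>' - 4 * \<alpha>' * \<gamma>' = \<beta> \<bullet> \<beta> - 4 * \<alpha> * \<gamma> \<and>
      (\<forall>p. v p * w (g p) * sphere_form \<alpha> \<beta> \<gamma> ((f \<circ> g) p) = sphere_form \<alpha>' \<beta>' \<gamma>' p)"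
    by metis
qed

text \<open>A Euclidean isometry fixing \<open>\<infinity>\<close> rescales nothing.\<close>

lemma conformal_weight_hyperplane_reflection:
  fixes a :: "'a::euclidean_space"
  assumes "a \<noteq> 0"
  shows "conformal_weight (\<lambda>p. 1) (hyperplane_reflection a b)"
proof -
  define N where "N = a \<bullet> a"
  define R where "R x = x - (2 * (a \<bullet> x - b) / N) *\<^sub>R a" for x
  have N: "N > 0" using assms by (simp add: N_def)
  have f: "hyperplane_reflection a b p = map_option R p" for p
    by (cases p) (simp_all add: hyperplane_reflection_def R_def N_def power2_norm_eq_inner)
  have dist: "(norm (R x - R y))\<^sup>2 = (norm (x - y))\<^sup>2" for x y
  proof -
    define z where "z = x - y"
    have "R x - R y = z - (2 * (a \<bullet> z) / N) *\<^sub>R a"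
      unfolding R_def z_def
      by (simp add: algebra_simps diff_divide_distrib add_divide_distrib)
    moreover have "(norm (z - (2 * (a \<bullet> z) / N) *\<^sub>R a))\<^sup>2 = (norm z)\<^sup>2"
      unfolding power2_norm_eq_inner using N
      by (simp add: inner_diff_left inner_diff_right inner_commute[of z a]
          N_def[symmetric] field_simps)
    ultimately show ?thesis by (simp add: z_def)
  qed
  have form: "\<exists>\<alpha>' \<beta>' \<gamma>'. \<beta>' \<bullet> \<beta>' - 4 * \<alpha>' * \<gamma>' = \<beta> \<bullet> \<beta> - 4 * \<alpha> * \<gamma> \<and>
        (\<forall>p. 1 * sphere_form \<alpha> \<beta> \<gamma> (hyperplane_reflection a b p) = sphere_form \<alpha>' \<beta>' \<gamma>' p)"
    for \<alpha> \<gamma> :: real and \<beta> :: 'a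
  proof (intro exI conjI allI)
    \<comment> \<open>From \<open>R x = x - (2 (a \<bullet> x - b) / N) a\<close> and \<open>|R x|\<^sup>2 = |x|\<^sup>2 - (4 b / N) (a \<bullet> x - b)\<close>, the form
      changes by the multiple \<open>- ?m\<close> of \<open>a \<bullet> x - b\<close>.\<close>
    let ?m = "(4 * b * \<alpha> + 2 * (a \<bullet> \<beta>)) / N"
    let ?\<beta> = "\<beta> - ?m *\<^sub>R a"
    let ?\<gamma> = "\<gamma> + b * ?m"
    show "?\<beta> \<bullet> ?\<beta> - 4 * \<alpha> * ?\<gamma> = \<beta> \<bullet> \<beta> - 4 * \<alpha> * \<gamma>"
      using N by (simp add: inner_diff_left inner_diff_right inner_commute[of \<beta> a]
          N_def[symmetric] field_simps)
    fix p
    show "1 * sphere_form \<alpha> \<beta> \<gamma> (hyperplane_reflection a b p) = sphere_form \<alpha> ?\<beta> ?\<gamma> p"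
    proof (cases p)
      case None
      then show ?thesis by (simp add: f sphere_form_def)
    next
      case (Some x)
      have RR: "R x \<bullet> R x = x \<bullet> x - 4 * b * (a \<bullet> x - b) / N"
        using N by (simp add: R_def inner_diff_left inner_diff_right inner_commute[of x a]
            N_def[symmetric] field_simps)
      have \<beta>R: "\<beta> \<bullet> R x = \<beta> \<bullet> x - 2 * (a \<bullet> x - b) * (a \<bullet> \<beta>) / N"
        by (simp add: R_def inner_diff_right inner_commute[of \<beta> a])
      show ?thesis
        using N by (simp add: Some f sphere_form_def RR \<beta>R inner_diff_left field_simps)
    qed
  qed
  show ?thesis
    unfolding conformal_weight_def using form
    by (auto simp: f ext_dist_sq_def dist split: option.splits)
qed

text \<open>
  The weight at finite points other than the centre is dictated by the classical formula
  \<open>|f x - f y| = r\<^sup>2 |x - y| / (|x - a| |y - a|)\<close>. The centre and \<open>\<infinity>\<close> are interchanged, and comparing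
  their extended distances to a third point forces the weights \<open>r\<^sup>2\<close> and \<open>1 / r\<^sup>2\<close> there.
\<close>

lemma conformal_weight_sphere_inversion:
  fixes a :: "'a::euclidean_space"
  assumes "r > 0"
  shows "conformal_weight
           (\<lambda>p. case p of None \<Rightarrow> 1 / r\<^sup>2
                | Some x \<Rightarrow> if x = a then r\<^sup>2 else (norm (x - a))\<^sup>2 / r\<^sup>2)
           (sphere_inversion a r)"
    (is "conformal_weight ?w _")
proof -
  define J where "J z = (r\<^sup>2 / (z \<bullet> z)) *\<^sub>R z" for z :: 'a
  have f: "sphere_inversion a r (Some x) = (if x = a then None else Some (a + J (x - a)))"
    "sphere_inversion a r None = Some a" for x
    by (simp_all add: sphere_inversion_def J_def power_divide power2_norm_eq_inner)
  have JJ: "J z \<bullet> J z = r^4 / (z \<bullet> z)" if "z \<noteq> 0" for z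
    using that by (simp add: J_def field_simps eval_nat_numeral)
  have norm_J: "norm z * (norm z * (norm (J z) * norm (J z))) = r * (r * (r * r))" if "z \<noteq> 0" for z
    using JJ[OF that] that
    by (simp add: power2_norm_eq_inner[symmetric] field_simps eval_nat_numeral)
  have dist: "(z \<bullet> z / r\<^sup>2) * (y \<bullet> y / r\<^sup>2) * (norm (J z - J y))\<^sup>2 = (norm (z - y))\<^sup>2"
    if "z \<noteq> 0" "y \<noteq> 0" for z y
  proof -
    have eq: "(norm (J z - J y))\<^sup>2 = r^4 / (z \<bullet> z) - 2 * (r^4 / ((z \<bullet> z) * (y \<bullet> y)) * (z \<bullet> y)) + r^4 / (y \<bullet> y)"
      using that
      by (simp add: power2_norm_eq_inner inner_diff_left inner_diff_right JJ)
         (simp add: J_def inner_commute[of y z] field_simps eval_nat_numeral)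
    have "z \<bullet> z > 0" "y \<bullet> y > 0" using that by simp_all
    then show ?thesis unfolding eq unfolding power2_norm_eq_inner using assms
      by (simp add: inner_diff_left inner_diff_right
          inner_commute[of y z] field_simps eval_nat_numeral)
  qed
  have 2: "?w p * ?w q * ext_dist_sq (sphere_inversion a r p) (sphere_inversion a r q)
             = ext_dist_sq p q" for p q
  proof (cases p; cases q)
    fix x y assume pq: "p = Some x" "q = Some y"
    show ?thesis
      using dist[of "x - a" "y - a"] assms
      by (auto simp: pq f ext_dist_sq_def power2_norm_eq_inner inner_diff_left inner_diff_right inner_commute)
  qed (use assms in \<open>auto simp: f ext_dist_sq_def norm_J field_simps eval_nat_numeral\<close>)
  have form: "\<exists>\<alpha>' \<beta>' \<gamma>'. \<beta>' \<bullet> \<beta>' - 4 * \<alpha>' * \<gamma>' = \<beta> \<bullet> \<beta> - 4 * \<alpha> * \<gamma> \<and>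
        (\<forall>p. ?w p * sphere_form \<alpha> \<beta> \<gamma> (sphere_inversion a r p) = sphere_form \<alpha>' \<beta>' \<gamma>' p)"
    for \<alpha> \<gamma> :: real and \<beta> :: 'a
  proof (intro exI conjI allI)
    \<comment> \<open>\<open>P\<close> is the value of the form at the centre. In terms of \<open>z = x - a\<close> the pulled-back form is
      \<open>(P / r\<^sup>2) |z|\<^sup>2 + (\<beta> + 2 \<alpha> a) \<bullet> z + \<alpha> r\<^sup>2\<close>: inversion swaps the outer coefficients.\<close>
    define P where "P = \<alpha> * (a \<bullet> a) + \<beta> \<bullet> a + \<gamma>"
    let ?\<alpha> = "P / r\<^sup>2"
    let ?\<beta> = "\<beta> + (2 * \<alpha>) *\<^sub>R a - (2 * P / r\<^sup>2) *\<^sub>R a"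
    let ?\<gamma> = "P * (a \<bullet> a) / r\<^sup>2 - (\<beta> \<bullet> a + 2 * \<alpha> * (a \<bullet> a)) + \<alpha> * r\<^sup>2"
    have r: "r\<^sup>2 > 0" "r \<noteq> 0" using assms by simp_all
    have \<gamma>: "\<gamma> = P - \<alpha> * (a \<bullet> a) - \<beta> \<bullet> a" by (simp add: P_def)
    show "?\<beta> \<bullet> ?\<beta> - 4 * ?\<alpha> * ?\<gamma> = \<beta> \<bullet> \<beta> - 4 * \<alpha> * \<gamma>"
      unfolding \<gamma> using r
      by (simp add: inner_diff_left inner_diff_right inner_add_left inner_add_right
          inner_commute[of a \<beta>] field_simps eval_nat_numeral)
    fix p
    show "?w p * sphere_form \<alpha> \<beta> \<gamma> (sphere_inversion a r p) = sphere_form ?\<alpha> ?\<beta> ?\<gamma> p"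
    proof (cases p)
      case None
      then show ?thesis by (simp add: f sphere_form_def P_def)
    next
      case (Some x)
      show ?thesis
      proof (cases "x = a")
        case True
        then show ?thesis using r Some
          by (simp add: f sphere_form_def inner_diff_left inner_add_left field_simps eval_nat_numeral)
      next
        case False
        define z where "z = x - a"
        have x: "x = a + z" and z: "z \<bullet> z > 0" using False by (simp_all add: z_def)
        have "?w p * sphere_form \<alpha> \<beta> \<gamma> (sphere_inversion a r p)
            = (z \<bullet> z / r\<^sup>2) * (\<alpha> * ((a + J z) \<bullet> (a + J z)) + \<beta> \<bullet> (a + J z) + \<gamma>)"
          using False by (simp add: Some f sphere_form_def z_def power2_norm_eq_inner)
        also have "\<dots> = ?\<alpha> * (x \<bullet> x) + ?\<beta> \<bullet> x + ?\<gamma>"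
          unfolding \<gamma> x J_def using r z
          by (simp add: inner_diff_left inner_add_left inner_add_right
              inner_commute[of z a] field_simps eval_nat_numeral)
        finally show ?thesis by (simp add: Some sphere_form_def)
      qed
    qed
  qed
  have 1: "?w p > 0" for p
    using assms by (auto split: option.split)
  show ?thesis
    unfolding conformal_weight_def using 1 2 form by blast
qed

lemma moebius_imp_conformal_weight: "moebius f \<Longrightarrow> \<exists>w. conformal_weight w f"
  by (induction rule: moebius.induct)
     (blast intro: conformal_weight_hyperplane_reflection conformal_weight_sphere_inversion
        conformal_weight_compose)+

section \<open>Invariance of the normalised distance\<close>

lemma quadratic_pos_iff_pos:
  fixes a b c :: real
  assumes sgn: "\<And>t. a * t\<^sup>2 + b * t + c > 0 \<longleftrightarrow> t > 0"
  shows "a = 0" "b > 0" "c = 0"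
proof -
  have "((\<lambda>t. a * t\<^sup>2 + b * t + c) \<longlongrightarrow> a * 0\<^sup>2 + b * 0 + c) (at_right 0)"
    by (intro tendsto_intros)
  moreover have "eventually (\<lambda>t. 0 \<le> a * t\<^sup>2 + b * t + c) (at_right 0)"
    by (rule eventually_mono[OF eventually_at_right_less[of 0]]) (use sgn less_imp_le in blast)
  ultimately have "0 \<le> a * 0\<^sup>2 + b * 0 + c"
    by (rule tendsto_lowerbound) simp
  with sgn[of 0] show c: "c = 0" by simp
  show a: "a = 0"
  proof (rule ccontr)
    assume "a \<noteq> 0"
    \<comment> \<open>If \<open>a \<noteq> 0\<close>, the linear factor of \<open>t (a t + b)\<close> takes the value \<open>- |b| - 1 + b < 0\<close> at this
      nonzero \<open>t\<close>, so the product has the wrong sign there.\<close>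
    define t where "t = - (\<bar>b\<bar> + 1) / a"
    have "t * (a * t + b) > 0 \<longleftrightarrow> t > 0"
      using sgn[of t] c by (simp add: algebra_simps power2_eq_square)
    moreover have "a * t + b < 0" "t \<noteq> 0"
      using \<open>a \<noteq> 0\<close> by (auto simp: t_def)
    ultimately show False
      by (auto simp: zero_less_mult_iff)
  qed
  show "b > 0" using sgn[of 1] a c by simp
qed

text \<open>
  A sphere is never the boundary of the half-space, and among the linear forms cutting it out the
  discriminant fixes the scale. Restricting the form to the vertical line through a boundary point
  reduces the claim to quadratics in one variable.
\<close>

lemma sphere_form_pos_on_half_space:
  fixes \<beta> :: "real ^ 'n::finite"
  assumes sgn: "\<And>x. sphere_form \<alpha> \<beta> \<gamma> (Some x) > 0 \<longleftrightarrow> x \<in> half_space k"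
    and disc: "\<beta> \<bullet> \<beta> - 4 * \<alpha> * \<gamma> = 1"
  shows "sphere_form \<alpha> \<beta> \<gamma> (Some x) = x $ k"
proof -
  define e :: "real ^ 'n" where "e = axis k 1"
  have e: "v \<bullet> e = v $ k" "e \<bullet> v = v $ k" "e $ k = 1" for v
    by (simp_all add: e_def inner_axis inner_axis')
  have ray: "\<alpha> = 0" "\<beta> $ k > 0" "\<alpha> * (v \<bullet> v) + \<beta> \<bullet> v + \<gamma> = 0" if v: "v $ k = 0" for v
  proof -
    have "\<alpha> * t\<^sup>2 + \<beta> $ k * t + (\<alpha> * (v \<bullet> v) + \<beta> \<bullet> v + \<gamma>) > 0 \<longleftrightarrow> t > 0" for t
      using sgn[of "v + t *\<^sub>R e"]
      by (simp add: sphere_form_def half_space_def inner_add_left inner_add_right e v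
          algebra_simps power2_eq_square)
    from quadratic_pos_iff_pos[OF this]
    show "\<alpha> = 0" "\<beta> $ k > 0" "\<alpha> * (v \<bullet> v) + \<beta> \<bullet> v + \<gamma> = 0" by simp_all
  qed
  have "\<alpha> = 0" "\<beta> $ k > 0" "\<gamma> = 0" using ray[of 0] by simp_all
  then have perp: "\<beta> \<bullet> v = 0" if "v $ k = 0" for v using ray(3)[OF that] by simp
  have dec: "\<beta> \<bullet> v = \<beta> $ k * v $ k" for v
    using perp[of "v - (v $ k) *\<^sub>R e"] by (simp add: inner_diff_right e)
  have "(\<beta> $ k)\<^sup>2 = 1"
    using disc dec[of \<beta>] \<open>\<alpha> = 0\<close> by (simp add: power2_eq_square)
  with \<open>\<beta> $ k > 0\<close> have "\<beta> $ k = 1"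
    using power2_eq_1_iff[of "\<beta> $ k"] by auto
  with dec[of x] \<open>\<alpha> = 0\<close> \<open>\<gamma> = 0\<close> show ?thesis by (simp add: sphere_form_def)
qed

text \<open>
  The pullback of the height under \<open>f\<close> is the height itself, i.e. heights scale by \<open>1 / w\<close>. The same
  weights govern the distances, so they cancel in the quotient.
\<close>

lemma moebius_half_space_invariant:
  fixes k :: "'n::finite"
  assumes f: "moebius_preserving (half_space k) f"
    and x: "x \<in> half_space k" and y: "y \<in> half_space k"
    and fx: "f (Some x) = Some x'" and fy: "f (Some y) = Some y'"
  shows "norm (x' - y') / sqrt (x' $ k * y' $ k) = norm (x - y) / sqrt (x $ k * y $ k)"
proof -
  obtain w where w: "conformal_weight w f"
    using f moebius_imp_conformal_weight unfolding moebius_preserving_def by metis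
  define e :: "real ^ 'n" where "e = axis k 1"
  obtain \<alpha> \<beta> \<gamma> where disc: "\<beta> \<bullet> \<beta> - 4 * \<alpha> * \<gamma> = e \<bullet> e - 4 * 0 * 0"
    and form: "\<And>p. w p * sphere_form 0 e 0 (f p) = sphere_form \<alpha> \<beta> \<gamma> p"
    using w unfolding conformal_weight_def by metis
  have wpos: "w p > 0" for p using w by (simp add: conformal_weight_def)
  have image: "f ` Some ` half_space k = Some ` half_space k"
    using f by (simp add: moebius_preserving_def)
  have e: "sphere_form 0 e 0 p > 0 \<longleftrightarrow> p \<in> Some ` half_space k" for p
    by (auto simp: sphere_form_def e_def inner_axis' half_space_def split: option.splits)
  have "sphere_form \<alpha> \<beta> \<gamma> (Some v) > 0 \<longleftrightarrow> v \<in> half_space k" for v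
  proof -
    have "sphere_form \<alpha> \<beta> \<gamma> (Some v) > 0 \<longleftrightarrow> f (Some v) \<in> f ` Some ` half_space k"
      using wpos[of "Some v"] by (simp add: form[symmetric] zero_less_mult_iff e image)
    also have "\<dots> \<longleftrightarrow> v \<in> half_space k"
      using conformal_weight_inj[OF w] by (auto simp: inj_image_mem_iff)
    finally show ?thesis .
  qed
  then have "sphere_form \<alpha> \<beta> \<gamma> (Some v) = v $ k" for v
    by (rule sphere_form_pos_on_half_space) (use disc in \<open>simp add: e_def inner_axis'\<close>)
  then have height: "w (Some v) * v' $ k = v $ k" if "f (Some v) = Some v'" for v v'
    using form[of "Some v"] that by (simp add: sphere_form_def e_def inner_axis')
  let ?W = "sqrt (w (Some x) * w (Some y))"
  have W: "?W > 0" using wpos by simp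
  have "w (Some x) * w (Some y) * (norm (x' - y'))\<^sup>2 = (norm (x - y))\<^sup>2"
    using w fx fy by (metis (no_types, lifting) conformal_weight_def ext_dist_sq_def option.simps(5))
  then have 1: "norm (x - y) = ?W * norm (x' - y')"
    by (metis norm_ge_zero real_sqrt_abs abs_of_nonneg real_sqrt_mult)
  have "sqrt (x $ k * y $ k) = sqrt (w (Some x) * w (Some y) * (x' $ k * y' $ k))"
    by (simp add: height[OF fx, symmetric] height[OF fy, symmetric] mult_ac)
  then have 2: "sqrt (x $ k * y $ k) = ?W * sqrt (x' $ k * y' $ k)"
    by (simp only: real_sqrt_mult)
  show ?thesis unfolding 1 2 using W by (rule mult_divide_mult_cancel_left[OF less_imp_neq[symmetric], symmetric])
qed

section \<open>The Gromov hyperbolic metric of the half-space\<close>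

lemma infdist_frontier_half_space:
  fixes z :: "real ^ 'n::finite"
  assumes "z \<in> half_space k"
  shows "infdist z (frontier (half_space k)) = z $ k"
proof -
  have H: "half_space k = {x :: real ^ 'n. axis k 1 \<bullet> x > 0}"
    by (simp add: half_space_def inner_axis')
  have F: "frontier (half_space k) = {x :: real ^ 'n. x $ k = 0}"
    unfolding H using frontier_halfspace_gt[of "axis k 1 :: real ^ 'n" 0]
    by (simp add: inner_axis' axis_eq_0_iff)
  have z: "z $ k > 0" using assms by (simp add: half_space_def)
  show ?thesis
  proof (rule antisym)
    have "infdist z (frontier (half_space k)) \<le> dist z (z - (z $ k) *\<^sub>R axis k 1)"
      by (rule infdist_le) (simp add: F)
    also have "\<dots> = z $ k" using z by (simp add: dist_norm)
    finally show "infdist z (frontier (half_space k)) \<le> z $ k" .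
    have "z $ k \<le> dist z v" if "v $ k = 0" for v
      using component_le_norm_cart[of "z - v" k] that z by (simp add: dist_norm)
    moreover have "{v :: real ^ 'n. v $ k = 0} \<noteq> {}" by (auto intro: exI[of _ 0])
    ultimately show "z $ k \<le> infdist z (frontier (half_space k))"
      unfolding F by (subst infdist_notempty) (auto intro!: cINF_greatest)
  qed
qed

lemma gromov_half_space:
  fixes x y :: "real ^ 'n::finite"
  assumes "x \<in> half_space k" "y \<in> half_space k"
  shows "gromov_hyp_metric (half_space k) x y
    = 2 * ln (norm (x - y) / sqrt (x $ k * y $ k) + max (x $ k) (y $ k) / sqrt (x $ k * y $ k))"
  using assms
  by (simp add: gromov_hyp_metric_def infdist_frontier_half_space add_divide_distrib)

text \<open>
  The geometric mean \<open>g\<close> of the heights lies between the smaller and the larger one, and the larger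
  height exceeds the smaller by at most \<open>|x - y|\<close>.
\<close>

lemma height_ratio_bounds:
  fixes x y :: "real ^ 'n::finite"
  assumes "x \<in> half_space k" "y \<in> half_space k"
  defines "g \<equiv> sqrt (x $ k * y $ k)"
  shows "1 \<le> max (x $ k) (y $ k) / g"
    and "max (x $ k) (y $ k) / g \<le> norm (x - y) / g + 1"
proof -
  let ?M = "max (x $ k) (y $ k)" and ?m = "min (x $ k) (y $ k)"
  have pos: "x $ k > 0" "y $ k > 0" using assms by (simp_all add: half_space_def)
  then have g: "g > 0" by (simp add: g_def)
  have Mm: "x $ k * y $ k = ?M * ?m" by (simp add: max_def min_def)
  have "?m * ?m \<le> ?M * ?m" "?M * ?m \<le> ?M * ?M"
    using pos by (auto intro!: mult_mono simp: max_def min_def)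
  then have "sqrt (?m\<^sup>2) \<le> g" "g \<le> sqrt (?M\<^sup>2)"
    unfolding g_def Mm by (simp_all only: real_sqrt_le_iff power2_eq_square)
  then have "?m \<le> g" "g \<le> ?M" using pos by (simp_all add: real_sqrt_abs del: real_sqrt_le_iff)
  then show "1 \<le> ?M / g" using g by (simp add: field_simps)
  have "\<bar>x $ k - y $ k\<bar> \<le> norm (x - y)"
    using component_le_norm_cart[of "x - y" k] by simp
  then have "?M \<le> norm (x - y) + g" using \<open>?m \<le> g\<close> by linarith
  then show "?M / g \<le> norm (x - y) / g + 1"
    using g by (simp add: field_simps)
qed

text \<open>The argument is \<open>s + q' \<le> 2 s + 1 \<le> 2 (s + q)\<close>.\<close>

lemma ln_ratio_bound:
  fixes s q q' :: real
  assumes "s \<ge> 0" "q \<ge> 1" "q' \<ge> 1" "q' \<le> s + 1"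
  shows "2 * ln (s + q') \<le> 2 * ln (s + q) + 2 * ln 2"
proof -
  have "ln (s + q') \<le> ln (2 * (s + q))"
    using assms by simp
  also have "\<dots> = ln 2 + ln (s + q)" using assms by (intro ln_mult_pos) auto
  finally show ?thesis by simp
qed

lemma moebius_half_space_gromov_bounds:
  fixes k :: "'n::finite"
  assumes f: "moebius_preserving (half_space k) f"
    and x: "x \<in> half_space k" and y: "y \<in> half_space k"
  shows "gromov_hyp_metric (half_space k) x y - 2 * ln 2 \<le> gromov_hyp_image (half_space k) f x y"
    and "gromov_hyp_image (half_space k) f x y \<le> gromov_hyp_metric (half_space k) x y + 2 * ln 2"
proof -
  have "f (Some v) \<in> Some ` half_space k" if "v \<in> half_space k" for v
    using f that by (auto simp: moebius_preserving_def)
  with x y obtain x' y' where f': "f (Some x) = Some x'" "f (Some y) = Some y'"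
    and x': "x' \<in> half_space k" and y': "y' \<in> half_space k" by blast
  note s = moebius_half_space_invariant[OF f x y f']
  note b = height_ratio_bounds[OF x y] and b' = height_ratio_bounds[OF x' y', unfolded s]
  have nn: "0 \<le> norm (x - y) / sqrt (x $ k * y $ k)"
    using x y by (simp add: half_space_def)
  show "gromov_hyp_metric (half_space k) x y - 2 * ln 2 \<le> gromov_hyp_image (half_space k) f x y"
    using ln_ratio_bound[OF nn b'(1) b]
    by (simp add: gromov_hyp_image_def f' gromov_half_space[OF x y] gromov_half_space[OF x' y'] s)
  show "gromov_hyp_image (half_space k) f x y \<le> gromov_hyp_metric (half_space k) x y + 2 * ln 2"
    using ln_ratio_bound[OF nn b(1) b']
    by (simp add: gromov_hyp_image_def f' gromov_half_space[OF x y] gromov_half_space[OF x' y'] s)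
qed

section \<open>Sharpness\<close>

lemma unit_inversion_nonzero:
  "v \<noteq> 0 \<Longrightarrow> sphere_inversion 0 1 (Some v) = Some (v /\<^sub>R (norm v)\<^sup>2)"
  by (simp add: sphere_inversion_def power_divide inverse_eq_divide)

lemma unit_inversion_involution: "sphere_inversion 0 1 (sphere_inversion 0 1 p) = p"
  for p :: "'a::euclidean_space option"
proof (cases p)
  case (Some v)
  then show ?thesis
    by (cases "v = 0")
       (simp_all add: unit_inversion_nonzero sphere_inversion_def[of _ _ None]
         sphere_inversion_def[of _ _ "Some 0"] power2_eq_square field_simps)
qed (simp add: sphere_inversion_def)

lemma moebius_preserving_unit_inversion:
  "moebius_preserving (half_space (k::'n::finite)) (sphere_inversion 0 1)"
proof -
  let ?J = "sphere_inversion (0 :: real ^ 'n) 1"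
  have sub: "?J ` Some ` half_space k \<subseteq> Some ` half_space k"
  proof clarify
    fix v :: "real ^ 'n" assume v: "v \<in> half_space k"
    then have "v \<noteq> 0" by (auto simp: half_space_def)
    then show "?J (Some v) \<in> Some ` half_space k"
      using v by (simp add: unit_inversion_nonzero half_space_def)
  qed
  moreover have "Some ` half_space k \<subseteq> ?J ` Some ` half_space k"
  proof
    fix p assume p: "p \<in> Some ` half_space k"
    then have "?J p \<in> Some ` half_space k" using sub by blast
    then show "p \<in> ?J ` Some ` half_space k"
      using unit_inversion_involution[of p] by (metis imageI)
  qed
  ultimately show ?thesis
    by (simp add: moebius_preserving_def moebius.sphere)
qed

text \<open>
  A half-circle orthogonal to the boundary and ending at the centre of inversion is mapped to a
  vertical line. Hence two points of that half-circle at equal height, far apart relative to it,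
  correspond to two points of the line with the extreme ratio of heights. The dimension bound
  provides a horizontal direction, along which the line can be moved off the centre.
\<close>

lemma gromov_half_space_sharp:
  fixes k :: "'n::finite"
  assumes card: "CARD('n) \<ge> 2" and c: "c < 2 * ln 2"
  obtains x y x' y' where "x \<in> half_space k" "y \<in> half_space k" "x' \<in> half_space k" "y' \<in> half_space k"
    "sphere_inversion 0 1 (Some x) = Some x'" "sphere_inversion 0 1 (Some y) = Some y'"
    "gromov_hyp_metric (half_space k) x' y' + c < gromov_hyp_metric (half_space k) x y"
proof -
  \<comment> \<open>The parameter \<open>t\<close> is \<open>q\<close> for the points \<open>axis j 1 + t *\<^sub>R axis k 1\<close> and
    \<open>axis j 1 + (1 / t) *\<^sub>R axis k 1\<close>; then \<open>s = t - 1 / t\<close>.\<close>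
  have "((\<lambda>t::real. 2 * ln (t - 1 / t + t) - 2 * ln (t - 1 / t + 1)) \<longlongrightarrow> 2 * ln 2) at_top"
    by real_asymp
  from order_tendstoD(1)[OF this c]
  have "\<forall>\<^sub>F t::real in at_top. t > 1 \<and> c < 2 * ln (t - 1 / t + t) - 2 * ln (t - 1 / t + 1)"
    using eventually_gt_at_top[of "1::real"] by eventually_elim simp
  then obtain t :: real where t: "t > 1" "c < 2 * ln (t - 1 / t + t) - 2 * ln (t - 1 / t + 1)"
    using eventually_happens'[OF trivial_limit_at_top_linorder] by blast
  have "\<exists>j. j \<noteq> k"
  proof (rule ccontr)
    assume "\<not> ?thesis"
    then have "UNIV = {k}" by auto
    then have "CARD('n) = 1" by (metis card_1_singleton_iff One_nat_def)
    with card show False by simp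
  qed
  then obtain j where j: "j \<noteq> k" by blast
  define p :: "real \<Rightarrow> real ^ 'n" where "p h = axis j 1 + h *\<^sub>R axis k 1" for h
  have pk: "p h $ k = h" for h
    using j by (simp add: p_def axis_def)
  have pn: "(norm (p h))\<^sup>2 = 1 + h\<^sup>2" for h
    unfolding power2_norm_eq_inner
    using j by (simp add: p_def inner_add_left inner_add_right
        inner_axis_axis power2_eq_square)
  have J: "sphere_inversion 0 1 (Some (p h)) = Some (p h /\<^sub>R (1 + h\<^sup>2))" for h
    using unit_inversion_nonzero[of "p h"] pn[of h]
    by (metis norm_zero power_zero_numeral add_pos_nonneg less_irrefl zero_le_power2 zero_less_one)
  have diff: "norm (p t - p (1 / t)) = t - 1 / t"
  proof -
    have "p t - p (1 / t) = (t - 1 / t) *\<^sub>R axis k 1"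
      by (simp add: p_def scaleR_left_diff_distrib)
    moreover have "1 / t < t" using t(1) by (simp add: field_simps) (smt (verit) mult_less_cancel_right2)
    ultimately show ?thesis by simp
  qed
  define x y x' y' where "x = p t" and "y = p (1 / t)"
    and "x' = p t /\<^sub>R (1 + t\<^sup>2)" and "y' = p (1 / t) /\<^sub>R (1 + (1 / t)\<^sup>2)"
  have f: "sphere_inversion 0 1 (Some x) = Some x'" "sphere_inversion 0 1 (Some y) = Some y'"
    by (simp_all only: x_def y_def x'_def y'_def J)
  have H: "x \<in> half_space k" "y \<in> half_space k"
    using t by (simp_all add: x_def y_def half_space_def pk)
  have pos: "1 + t\<^sup>2 > 0" by (simp add: add_pos_nonneg)
  \<comment> \<open>Replacing \<open>t\<close> by \<open>1 / t\<close> leaves the height \<open>t / (1 + t\<^sup>2)\<close> of the image unchanged.\<close>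
  have h': "x' $ k = t / (1 + t\<^sup>2)" "y' $ k = t / (1 + t\<^sup>2)"
    using t(1) pos by (simp_all add: x'_def y'_def pk field_simps eval_nat_numeral)
  have H': "x' \<in> half_space k" "y' \<in> half_space k"
    using t pos by (simp_all add: half_space_def h')
  have s: "norm (x - y) / sqrt (x $ k * y $ k) = t - 1 / t"
    using t(1) by (simp add: x_def y_def pk diff)
  have s': "norm (x' - y') / sqrt (x' $ k * y' $ k) = t - 1 / t"
    using moebius_half_space_invariant[OF moebius_preserving_unit_inversion H f] s by simp
  have q: "max (x $ k) (y $ k) / sqrt (x $ k * y $ k) = t"
    using t(1) by (simp add: x_def y_def pk max_def field_simps) (smt (verit) mult_less_cancel_right2)
  have q': "max (x' $ k) (y' $ k) / sqrt (x' $ k * y' $ k) = 1"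
  proof -
    have "y' $ k = x' $ k" "x' $ k > 0" using H'(1) by (simp_all only: h' half_space_def mem_Collect_eq)
    then show ?thesis by simp
  qed
  show thesis
  proof (rule that[OF H H' f])
    show "gromov_hyp_metric (half_space k) x' y' + c < gromov_hyp_metric (half_space k) x y"
      using t(2) by (simp only: gromov_half_space[OF H] gromov_half_space[OF H'] s s' q q')
  qed
qed

theorem theorem6p5:
  fixes k :: "'n::finite"
  defines "H \<equiv> half_space k"
  shows
    "(\<forall>f. moebius_preserving H f \<longrightarrow>
        (\<forall>x\<in>H. \<forall>y\<in>H.
           gromov_hyp_metric H x y - 2 * ln 2 \<le> gromov_hyp_image H f x y \<and>
           gromov_hyp_image H f x y \<le> gromov_hyp_metric H x y + 2 * ln 2)) \<and>
     (CARD('n) \<ge> 2 \<longrightarrow>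
        (\<forall>c < 2 * ln 2.
           \<not> (\<forall>f. moebius_preserving H f \<longrightarrow>
                (\<forall>x\<in>H. \<forall>y\<in>H. gromov_hyp_metric H x y - c \<le> gromov_hyp_image H f x y))) \<and>
        (\<forall>c < 2 * ln 2.
           \<not> (\<forall>f. moebius_preserving H f \<longrightarrow>
                (\<forall>x\<in>H. \<forall>y\<in>H. gromov_hyp_image H f x y \<le> gromov_hyp_metric H x y + c))))"
proof (intro conjI impI allI ballI notI)
  fix f x y assume "moebius_preserving H f" "x \<in> H" "y \<in> H"
  then show "gromov_hyp_metric H x y - 2 * ln 2 \<le> gromov_hyp_image H f x y"
    "gromov_hyp_image H f x y \<le> gromov_hyp_metric H x y + 2 * ln 2"
    unfolding H_def by (rule moebius_half_space_gromov_bounds)+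
next
  fix c :: real
  assume n: "CARD('n) \<ge> 2" and c: "c < 2 * ln 2"
    and all: "\<forall>f. moebius_preserving H f \<longrightarrow>
      (\<forall>x\<in>H. \<forall>y\<in>H. gromov_hyp_metric H x y - c \<le> gromov_hyp_image H f x y)"
  obtain x y x' y' where "x \<in> H" "y \<in> H"
    "sphere_inversion 0 1 (Some x) = Some x'" "sphere_inversion 0 1 (Some y) = Some y'"
    "gromov_hyp_metric H x' y' + c < gromov_hyp_metric H x y"
    using gromov_half_space_sharp[OF n c, of k] unfolding H_def by metis
  moreover have "gromov_hyp_metric H x y - c \<le> gromov_hyp_image H (sphere_inversion 0 1) x y"
    using all moebius_preserving_unit_inversion[of k] calculation unfolding H_def by blast
  ultimately show False by (simp add: gromov_hyp_image_def)
next
  fix c :: real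
  assume n: "CARD('n) \<ge> 2" and c: "c < 2 * ln 2"
    and all: "\<forall>f. moebius_preserving H f \<longrightarrow>
      (\<forall>x\<in>H. \<forall>y\<in>H. gromov_hyp_image H f x y \<le> gromov_hyp_metric H x y + c)"
  obtain x y x' y' where *: "x' \<in> H" "y' \<in> H"
    "sphere_inversion 0 1 (Some x) = Some x'" "sphere_inversion 0 1 (Some y) = Some y'"
    "gromov_hyp_metric H x' y' + c < gromov_hyp_metric H x y"
    using gromov_half_space_sharp[OF n c, of k] unfolding H_def by metis
  \<comment> \<open>Read backwards, the inversion takes the points of equal height to the vertical pair.\<close>
  have "sphere_inversion 0 1 (Some x') = Some x" "sphere_inversion 0 1 (Some y') = Some y"
    using unit_inversion_involution *(3,4) by metis+
  moreover have "gromov_hyp_image H (sphere_inversion 0 1) x' y' \<le> gromov_hyp_metric H x' y' + c"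
    using all moebius_preserving_unit_inversion[of k] *(1,2) unfolding H_def by blast
  ultimately show False using *(5) by (simp add: gromov_hyp_image_def)
qed

end
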